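(* Let $G=(V,E)$ be a $d$-regular graph on $n$ vertices with $\lambda<d$, where $\lambda$ is as defined in the context. For a given step $t$ of the Random Growth process on $G$, let $P$ be the processed vertices, $Q$ the queue, $W=P\sqcup Q$ the visited vertices, and $U$ the unvisited vertices. Then \[ \frac{(d - \lambda) \cdot |W|^2}{(d - \lambda)\cdot|W| - e(U, W)} \ \geq \ n \ \geq \ \frac{(d + \lambda)\cdot|W|^2}{(d + \lambda)\cdot|W| - e(U, W)} \enspace .\]
   Context: For a graph $G$ with adjacency matrix having eigenvalues $\lambda_1\geq\dots\geq\lambda_n$, $\lambda=\max\{|\lambda_2|,|\lambda_n|\}$. For $S,T\subseteq V$, $e(S,T)$ is the number of pairs $(s,t)$ with $s\in S$, $t\in T$ and $\{s,t\}\in E$ (edges with both endpoints in $S\cap T$ counted twice). Random Growth process on a connected graph $G$ with start vertex $v_1$: maintain a partition of $V$ into $P$ (processed), $Q$ (queue), $U$ (unvisited); initially $P=\emptyset$, $Q=\{v_1\}$, $U=V\setminus\{v_1\}$. While $Q\neq\emptyset$: pick $v$ uniformly at random from $Q$; let $N$ be the neighbors of $v$ in $U$; set $P\leftarrow P\cup\{v\}$, $Q\leftarrow(Q\setminus\{v\})\cup N$, $U\leftarrow U\setminus N$.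
   Formalization: The left inequality is asserted only when (d−λ)|W| − e(U,W) > 0; otherwise it is false or undefined, e.g. for K_n (n ≥ 3) at t = 0 the fraction equals −(n−2) < n. The right denominator is proved positive. *)

theory Defs
  imports
    "HOL-Library.Multiset"
    "HOL-Probability.Probability_Mass_Function"
    "Jordan_Normal_Form.Char_Poly"
begin

definition simple_graph :: "'a set \<Rightarrow> 'a set set \<Rightarrow> bool" where
  "simple_graph V E \<longleftrightarrow> finite V \<and> (\<forall>e\<in>E. e \<subseteq> V \<and> card e = 2)"

definition regular_graph :: "'a set \<Rightarrow> 'a set set \<Rightarrow> nat \<Rightarrow> bool" where
  "regular_graph V E d \<longleftrightarrow> (\<forall>v\<in>V. card {u \<in> V. {v, u} \<in> E} = d)"

text \<open>Ordered pairs are counted, so an edge with both endpoints in the intersection of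
  the two sets contributes twice.\<close>

definition edge_count :: "'a set set \<Rightarrow> 'a set \<Rightarrow> 'a set \<Rightarrow> nat" where
  "edge_count E S T = card {(s, t). s \<in> S \<and> t \<in> T \<and> {s, t} \<in> E}"

text \<open>The rows and columns are indexed along a list \<open>vs\<close> that enumerates the vertices
  without repetition.\<close>

definition adj_matrix :: "'a list \<Rightarrow> 'a set set \<Rightarrow> real mat" where
  "adj_matrix vs E =
     Matrix.mat (length vs) (length vs) (\<lambda>(i, j). if {vs ! i, vs ! j} \<in> E then 1 else 0)"

text \<open>The real eigenvalues in non-increasing order, repeated according to algebraic
  multiplicity. An adjacency matrix is symmetric, so these are all of its eigenvalues.\<close>

definition eigenvalue_list :: "real mat \<Rightarrow> real list" where
  "eigenvalue_list A = rev (sorted_list_of_multiset (proots (char_poly A)))"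

text \<open>List indices start at 0, so index 1 is the second largest eigenvalue and the last
  entry is the smallest. The value is meaningful for graphs with at least two vertices.\<close>

definition graph_lambda :: "'a list \<Rightarrow> 'a set set \<Rightarrow> real" where
  "graph_lambda vs E =
     (let es = eigenvalue_list (adj_matrix vs E) in max \<bar>es ! 1\<bar> \<bar>last es\<bar>)"

text \<open>A state is the triple of processed, queued and unvisited vertices. Once the queue is
  empty the process has stopped, and the state stays constant.\<close>

type_synonym 'a growth_state = "'a set \<times> 'a set \<times> 'a set"

definition growth_update :: "'a set set \<Rightarrow> 'a growth_state \<Rightarrow> 'a \<Rightarrow> 'a growth_state" where
  "growth_update E = (\<lambda>(P, Q, U) v.
     let N = {u \<in> U. {v, u} \<in> E} in (P \<union> {v}, (Q - {v}) \<union> N, U - N))"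

definition growth_step :: "'a set set \<Rightarrow> 'a growth_state \<Rightarrow> 'a growth_state pmf" where
  "growth_step E = (\<lambda>(P, Q, U).
     if Q = {} then return_pmf (P, Q, U)
     else map_pmf (growth_update E (P, Q, U)) (pmf_of_set Q))"

primrec random_growth :: "'a set \<Rightarrow> 'a set set \<Rightarrow> 'a \<Rightarrow> nat \<Rightarrow> 'a growth_state pmf" where
  "random_growth V E v1 0 = return_pmf ({}, {v1}, V - {v1})"
| "random_growth V E v1 (Suc t) = bind_pmf (random_growth V E v1 t) (growth_step E)"

end

theory Submission
  imports Defs
begin

text \<open>By compactness, a symmetric form having the all-ones vector as eigenvector attains its extreme
  Rayleigh quotients on the orthogonal complement of that vector, and it does so at
  eigenvectors. For a regular graph with \<open>\<lambda> < d\<close> the eigenvalue \<open>d\<close> is simple, so these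
  extreme eigenvalues are among the nontrivial ones and lie in \<open>[-\<lambda>, \<lambda>]\<close>. Applied to the
  projection \<open>1\<^sub>W - |W| / n\<close> this gives the expander mixing bounds
  \<open>(d - \<lambda>) |W| (n - |W|) \<le> n e(U, W) \<le> (d + \<lambda>) |W| (n - |W|)\<close>, which rearrange to the claim.
  The random process only matters through \<open>v1 \<in> W\<close> and \<open>U = V - W\<close>.\<close>

section \<open>Eigenvectors, principal minors and multiplicities\<close>

text \<open>Lets an eigenvector be a plain function of the index, so that eigenvector equations are
  ordinary sums that can be reindexed by vertices or by the rows of a minor.\<close>

lemma eigenvalue_if_sum:
  fixes A :: "'b::field mat"
  assumes A: "A \<in> carrier_mat n n"
    and eig: "\<And>i. i < n \<Longrightarrow> (\<Sum>j<n. A $$ (i, j) * x j) = k * x i"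
    and nz: "i < n" "x i \<noteq> 0"
  shows "eigenvalue A k"
proof -
  let ?v = "Matrix.vec n x"
  have "A *\<^sub>v ?v = k \<cdot>\<^sub>v ?v"
  proof (rule eq_vecI)
    fix r assume "r < dim_vec (k \<cdot>\<^sub>v ?v)"
    then show "vec_index (A *\<^sub>v ?v) r = vec_index (k \<cdot>\<^sub>v ?v) r"
      using A eig[of r] by (simp add: scalar_prod_def lessThan_atLeast0)
  qed (use A in auto)
  moreover have "?v \<noteq> 0\<^sub>v n"
    using nz by (metis index_vec index_zero_vec(1))
  ultimately show ?thesis
    using A unfolding eigenvalue_def eigenvector_def by (intro exI[of _ ?v]) auto
qed

text \<open>Since \<open>x\<close> vanishes at \<open>i\<close>, deleting column \<open>i\<close>
  removes only zero terms from the eigenvector equation. The restriction of \<open>x\<close>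
  therefore solves it for the minor, and the entry at \<open>j\<close> keeps it nonzero.\<close>

lemma eigenvalue_mat_delete:
  fixes A :: "'b::field mat"
  assumes A: "A \<in> carrier_mat n n"
    and eig: "\<And>r. r < n \<Longrightarrow> (\<Sum>c<n. A $$ (r, c) * x c) = k * x r"
    and i: "i < n" "x i = 0" and j: "j < n" "x j \<noteq> 0"
  shows "eigenvalue (mat_delete A i i) k"
proof -
  obtain m where n: "n = Suc m"
    using i(1) by (cases n) auto
  let ?f = "insert_index i"
  \<comment> \<open>\<open>insert_index i\<close> skips \<open>i\<close>; its inverse shifts the
    indices above \<open>i\<close> down by one.\<close>
  have bij: "bij_betw ?f {..<m} ({..<n} - {i})"
    by (rule bij_betwI[where g = "\<lambda>r. if r < i then r else r - 1"])
      (use i n in \<open>auto simp: insert_index_def split: if_splits\<close>)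
  have "j \<in> ?f ` {..<m}"
    using bij j i unfolding bij_betw_def by auto
  then obtain j' where j': "j' < m" "j = ?f j'"
    by auto
  show ?thesis
  proof (rule eigenvalue_if_sum)
    show "mat_delete A i i \<in> carrier_mat m m"
      using mat_delete_carrier[OF A, of i i] n by simp
    show "(\<Sum>c<m. mat_delete A i i $$ (r, c) * x (?f c)) = k * x (?f r)" if r: "r < m" for r
    proof -
      have fr: "?f r < n"
        using r n by (auto simp: insert_index_def)
      have "(\<Sum>c<m. mat_delete A i i $$ (r, c) * x (?f c)) = (\<Sum>c<m. A $$ (?f r, ?f c) * x (?f c))"
        using r i A n by (intro sum.cong refl) (simp add: mat_delete_index)
      also have "\<dots> = (\<Sum>c\<in>{..<n} - {i}. A $$ (?f r, c) * x c)"
        by (rule sum.reindex_bij_betw[OF bij])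
      also have "\<dots> = (\<Sum>c<n. A $$ (?f r, c) * x c)"
        by (rule sum.mono_neutral_left) (use i in auto)
      finally show ?thesis
        using eig[OF fr] by simp
    qed
    show "j' < m" and "x (?f j') \<noteq> 0"
      using j' j by auto
  qed
qed

text \<open>The derivative of the characteristic polynomial is the sum of the characteristic
  polynomials of the principal minors. A two-dimensional eigenspace contains a nonzero vector
  vanishing at any prescribed coordinate, so each of these minors has the same eigenvalue.\<close>

lemma order_char_poly_ge_2:
  fixes A :: "'b::field_char_0 mat"
  assumes A: "A \<in> carrier_mat n n"
    and v: "\<And>r. r < n \<Longrightarrow> (\<Sum>c<n. A $$ (r, c) * v c) = k * v r"
    and w: "\<And>r. r < n \<Longrightarrow> (\<Sum>c<n. A $$ (r, c) * w c) = k * w r"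
    and indep: "\<And>a b. (\<And>i. i < n \<Longrightarrow> a * v i + b * w i = 0) \<Longrightarrow> a = 0 \<and> b = 0"
  shows "order k (char_poly A) \<ge> 2"
proof -
  let ?p = "char_poly A"
  have comb: "(\<Sum>c<n. A $$ (r, c) * (a * v c + b * w c)) = k * (a * v r + b * w r)"
    if "r < n" for a b r
  proof -
    have "(\<Sum>c<n. A $$ (r, c) * (a * v c + b * w c))
        = a * (\<Sum>c<n. A $$ (r, c) * v c) + b * (\<Sum>c<n. A $$ (r, c) * w c)"
      by (simp add: algebra_simps sum.distrib sum_distrib_left)
    also have "\<dots> = k * (a * v r + b * w r)"
      unfolding v[OF that] w[OF that] by (simp add: algebra_simps)
    finally show ?thesis .
  qed
  have "poly (char_poly (mat_delete A i i)) k = 0" if i: "i < n" for i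
  proof -
    obtain a b where ab: "a \<noteq> 0 \<or> b \<noteq> 0" "a * v i + b * w i = 0"
    proof (cases "v i = 0")
      case True
      then show ?thesis by (intro that[of 1 0]) auto
    next
      case False
      then show ?thesis by (intro that[of "- w i" "v i"]) auto
    qed
    obtain j where j: "j < n" "a * v j + b * w j \<noteq> 0"
      using ab(1) indep[of a b] by blast
    have "eigenvalue (mat_delete A i i) k"
      by (rule eigenvalue_mat_delete[where x = "\<lambda>i. a * v i + b * w i", OF A comb i ab(2) j])
    then show ?thesis
      using eigenvalue_root_char_poly[OF mat_delete_carrier[OF A]] by blast
  qed
  then have dp: "poly (pderiv ?p) k = 0"
    by (simp add: pderiv_char_poly[OF A] poly_sum)
  have p0: "?p \<noteq> 0"
    using degree_monic_char_poly[OF A] by auto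
  obtain j where j: "j < n" "v j \<noteq> 0"
    using indep[of 1 0] by auto
  have "eigenvalue A k"
    by (rule eigenvalue_if_sum[OF A v j])
  then have root: "poly ?p k = 0"
    using eigenvalue_root_char_poly[OF A] by blast
  have ord: "order k ?p = Suc (order k (pderiv ?p))"
    by (rule order_pderiv[OF p0 root])
  \<comment> \<open>A root of the derivative has positive order only if the derivative is nonzero.
    In characteristic zero this holds because the degree is \<open>n\<close>, which is positive as
    \<open>j < n\<close>.\<close>
  have "pderiv ?p \<noteq> 0"
  proof
    assume "pderiv ?p = 0"
    then have "degree ?p = 0"
      by (simp add: pderiv_eq_0_iff)
    then show False
      using degree_monic_char_poly[OF A] j(1) by auto
  qed
  then have "order k (pderiv ?p) \<noteq> 0"
    using dp order_root by blast
  then show ?thesis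
    using ord by simp
qed

section \<open>Position in the sorted spectrum\<close>

text \<open>Every entry after the head lies between the last entry and the entry at index 1, so its
  absolute value is below \<open>d\<close>. Hence \<open>d\<close> occurs only as the head, and
  cancelling that one copy leaves \<mu> in the tail. Multiset inclusion makes the case of \<mu>
  equal to \<open>d\<close> demand two copies.\<close>

lemma abs_le_second_eigenvalue:
  fixes A :: "real mat" and d \<mu> :: real
  defines "es \<equiv> eigenvalue_list A"
  assumes sub: "{#d, \<mu>#} \<subseteq># proots (char_poly A)"
    and less: "max \<bar>es ! 1\<bar> \<bar>last es\<bar> < d"
  shows "\<bar>\<mu>\<bar> \<le> max \<bar>es ! 1\<bar> \<bar>last es\<bar>"
proof -
  let ?m = "max \<bar>es ! 1\<bar> \<bar>last es\<bar>"
  have mset: "mset es = proots (char_poly A)"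
    by (simp add: es_def eigenvalue_list_def)
  have sorted: "sorted_wrt (\<ge>) es"
    unfolding es_def eigenvalue_list_def sorted_wrt_rev by simp
  obtain x ys where es: "es = x # ys"
    using sub mset by (cases es) auto
  have tail: "\<bar>y\<bar> \<le> ?m" if y: "y \<in> set ys" for y
  proof -
    obtain z zs where ys: "ys = z # zs"
      using y by (cases ys) auto
    have "y \<le> es ! 1"
      using sorted y unfolding es ys by auto
    moreover have "last es \<le> y"
    proof -
      have l: "ys = butlast ys @ [last ys]"
        using ys by simp
      then have "sorted_wrt (\<ge>) (butlast ys @ [last ys])"
        using sorted es by simp
      moreover have "y \<in> set (butlast ys) \<or> y = last ys"
        using y l by (metis Un_iff empty_iff empty_set set_ConsD set_append)
      ultimately show ?thesis
        using es ys by (auto simp: sorted_wrt_append)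
    qed
    ultimately show ?thesis by linarith
  qed
  have "d \<notin> set ys"
    using tail[of d] less by linarith
  moreover have "d \<in># mset es"
    using sub mset by (metis insert_subset_eq_iff)
  ultimately have "x = d"
    using es by auto
  then have "{#\<mu>#} \<subseteq># mset ys"
    using sub mset es by (metis add_mset_add_single mset.simps(2) mset_subset_eq_add_mset_cancel)
  then have "\<mu> \<in> set ys"
    by simp
  then show ?thesis by (rule tail)
qed

section \<open>Extreme Rayleigh quotients by compactness\<close>

text \<open>Vectors are functions on the whole index type, under the product topology. Forcing them
  to vanish outside \<open>I\<close> places the sphere as a closed subset of a product of compact
  sets, which is compact by Tychonoff.\<close>

lemma compact_sphere_sum_zero:
  fixes I :: "'i set"
  assumes "finite I"
  shows "compact {x :: 'i \<Rightarrow> real. (\<forall>i. i \<notin> I \<longrightarrow> x i = 0) \<and> (\<Sum>i\<in>I. x i) = 0 \<and> (\<Sum>i\<in>I. (x i)\<^sup>2) = 1}"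
    (is "compact ?K")
proof -
  define S where "S = (\<lambda>i. if i \<in> I then {-1..1::real} else {0})"
  have "compactin (product_topology (\<lambda>i. euclidean) UNIV) (PiE UNIV S)"
    unfolding compactin_PiE by (auto simp: S_def)
  then have comp: "compact (PiE UNIV S)"
    by (simp add: euclidean_product_topology)
  have cont: "continuous_on UNIV (\<lambda>x. x i)" for i :: 'i
    by (rule continuous_on_product_coordinates)
  have "closed {x :: 'i \<Rightarrow> real. (\<Sum>i\<in>I. x i) = 0}"
    by (intro closed_Collect_eq continuous_intros cont)
  moreover have "closed {x :: 'i \<Rightarrow> real. (\<Sum>i\<in>I. (x i)\<^sup>2) = 1}"
    by (intro closed_Collect_eq continuous_intros cont)
  ultimately have "compact (PiE UNIV S \<inter> ({x. (\<Sum>i\<in>I. x i) = 0} \<inter> {x. (\<Sum>i\<in>I. (x i)\<^sup>2) = 1}))"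
    by (intro compact_Int_closed comp closed_Int)
  moreover have "\<bar>x i\<bar> \<le> 1" if "(\<Sum>i\<in>I. (x i)\<^sup>2) = 1" "i \<in> I" for x :: "'i \<Rightarrow> real" and i
  proof -
    have "(x i)\<^sup>2 \<le> (\<Sum>i\<in>I. (x i)\<^sup>2)"
      by (rule member_le_sum) (use that assms in auto)
    then show ?thesis
      using that by (simp add: abs_square_le_1)
  qed
  then have "PiE UNIV S \<inter> ({x. (\<Sum>i\<in>I. x i) = 0} \<inter> {x. (\<Sum>i\<in>I. (x i)\<^sup>2) = 1}) = ?K"
    by (fastforce simp: S_def PiE_iff abs_le_iff split: if_splits)
  ultimately show ?thesis by simp
qed

text \<open>This is the first-order condition at a minimum: the quadratic takes its least value 0 at
  \<open>t = 0\<close>, so its slope there vanishes.\<close>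

lemma linear_coeff_zero_if_nonneg:
  fixes b c :: real
  assumes "\<And>t. 0 \<le> 2 * t * b + t\<^sup>2 * c"
  shows "b = 0"
proof (rule ccontr)
  assume b: "b \<noteq> 0"
  define s where "s = \<bar>c\<bar> + 1"
  have s: "s > 0" "c \<le> s" by (auto simp: s_def)
  \<comment> \<open>The point \<open>- b / s\<close> minimises the quadratic with \<open>c\<close>
    replaced by its positive upper bound \<open>s\<close>, which covers either sign of
    \<open>c\<close>.\<close>
  have "0 \<le> 2 * (- b / s) * b + (- b / s)\<^sup>2 * c"
    by (rule assms)
  also have "\<dots> \<le> 2 * (- b / s) * b + (- b / s)\<^sup>2 * s"
    using s by (intro add_left_mono mult_left_mono) auto
  also have "\<dots> = - (b\<^sup>2 / s)"
    using s by (simp add: power2_eq_square field_simps)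
  also have "\<dots> < 0"
    using b s by simp
  finally show False by simp
qed

text \<open>A maximiser \<open>z\<close> of the form exists on the compact unit sphere of sum-zero
  vectors. Varying it along its own residual \<open>g\<close> shows that \<open>g\<close> vanishes,
  so \<open>z\<close> is an eigenvector whose eigenvalue is the maximum. Constant row sums keep
  \<open>g\<close> in the sum-zero space.\<close>

lemma rayleigh_max:
  fixes a :: "'i \<Rightarrow> 'i \<Rightarrow> real"
  assumes fin: "finite I" and card: "card I \<ge> 2"
    and sym: "\<And>i j. a i j = a j i"
    and rows: "\<And>i. i \<in> I \<Longrightarrow> (\<Sum>j\<in>I. a i j) = d"
  obtains z \<mu> where "(\<Sum>i\<in>I. z i) = 0" and "\<exists>i\<in>I. z i \<noteq> 0"
    and "\<And>i. i \<in> I \<Longrightarrow> (\<Sum>j\<in>I. a i j * z j) = \<mu> * z i"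
    and "\<And>x. (\<Sum>i\<in>I. x i) = 0 \<Longrightarrow> (\<Sum>i\<in>I. \<Sum>j\<in>I. a i j * x i * x j) \<le> \<mu> * (\<Sum>i\<in>I. (x i)\<^sup>2)"
proof -
  let ?K = "{x :: 'i \<Rightarrow> real. (\<forall>i. i \<notin> I \<longrightarrow> x i = 0) \<and> (\<Sum>i\<in>I. x i) = 0 \<and> (\<Sum>i\<in>I. (x i)\<^sup>2) = 1}"
  define q where "q x = (\<Sum>i\<in>I. \<Sum>j\<in>I. a i j * x i * x j)" for x :: "'i \<Rightarrow> real"
  have scale: "(\<lambda>i. if i \<in> I then x i / sqrt (\<Sum>i\<in>I. (x i)\<^sup>2) else 0) \<in> ?K"
    if "(\<Sum>i\<in>I. x i) = 0" "(\<Sum>i\<in>I. (x i)\<^sup>2) > 0" for x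
  proof -
    let ?y = "\<lambda>i. if i \<in> I then x i / sqrt (\<Sum>i\<in>I. (x i)\<^sup>2) else 0"
    have "(\<Sum>i\<in>I. ?y i) = (\<Sum>i\<in>I. x i) / sqrt (\<Sum>i\<in>I. (x i)\<^sup>2)"
      unfolding sum_divide_distrib by (rule sum.cong) auto
    moreover have "(\<Sum>i\<in>I. (?y i)\<^sup>2) = (\<Sum>i\<in>I. (x i)\<^sup>2) / (\<Sum>i\<in>I. (x i)\<^sup>2)"
      unfolding sum_divide_distrib by (rule sum.cong) (use that in \<open>auto simp: power_divide\<close>)
    ultimately show ?thesis
      using that by simp
  qed
  have pos: "(\<Sum>i\<in>I. (x i)\<^sup>2) > 0" if "i \<in> I" "x i \<noteq> 0" for x :: "'i \<Rightarrow> real" and i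
    by (rule sum_pos2[OF fin that(1)]) (use that in auto)
  have "compact ?K"
    by (rule compact_sphere_sum_zero[OF fin])
  moreover have "?K \<noteq> {}"
  proof -
    obtain u v where uv: "u \<in> I" "v \<in> I" "u \<noteq> v"
    proof -
      have "\<not> card I \<le> Suc 0"
        using card by linarith
      then show ?thesis
        unfolding card_le_Suc0_iff_eq[OF fin] using that by blast
    qed
    \<comment> \<open>The difference of two unit vectors has sum zero; normalising it gives a point
      of the sphere.\<close>
    define x :: "'i \<Rightarrow> real" where "x = (\<lambda>i. (if i = u then 1 else 0) - (if i = v then 1 else 0))"
    have "(\<Sum>i\<in>I. x i) = 0"
      using uv fin by (simp add: x_def sum_subtractf)
    moreover have "(\<Sum>i\<in>I. (x i)\<^sup>2) > 0"
      by (rule pos[OF uv(1)]) (use uv in \<open>simp add: x_def\<close>)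
    ultimately show ?thesis
      using scale[of x] by (metis empty_iff)
  qed
  moreover have "continuous_on ?K q"
  proof (rule continuous_on_subset[OF _ subset_UNIV])
    show "continuous_on UNIV q"
      unfolding q_def by (intro continuous_intros continuous_on_product_coordinates)
  qed
  ultimately obtain z where z: "z \<in> ?K" and max: "\<And>x. x \<in> ?K \<Longrightarrow> q x \<le> q z"
    using continuous_attains_sup[of ?K q] by blast
  define \<mu> where "\<mu> = q z"
  have bound: "q x \<le> \<mu> * (\<Sum>i\<in>I. (x i)\<^sup>2)" if x: "(\<Sum>i\<in>I. x i) = 0" for x
  proof (cases "\<exists>i\<in>I. x i \<noteq> 0")
    case True
    then have s: "(\<Sum>i\<in>I. (x i)\<^sup>2) > 0" (is "?s > 0")
      using pos by blast
    have "q (\<lambda>i. if i \<in> I then x i / sqrt ?s else 0) \<le> \<mu>"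
      unfolding \<mu>_def by (rule max[OF scale[OF x s]])
    moreover have "q (\<lambda>i. if i \<in> I then x i / sqrt ?s else 0) = q x / ?s"
    proof -
      have "a i j * (x i / sqrt ?s) * (x j / sqrt ?s) = a i j * x i * x j / ?s" for i j
        using s by simp
      then show ?thesis
        unfolding q_def sum_divide_distrib using s by (simp add: abs_of_pos[OF s])
    qed
    ultimately show ?thesis
      using s by (simp add: field_simps)
  next
    case False
    then show ?thesis by (simp add: q_def)
  qed
  define g where "g i = \<mu> * z i - (\<Sum>j\<in>I. a i j * z j)" for i
  have sum_z: "(\<Sum>i\<in>I. z i) = 0" and norm_z: "(\<Sum>i\<in>I. (z i)\<^sup>2) = 1"
    using z by auto
  \<comment> \<open>By symmetry the column sums are also \<open>d\<close>, so the form maps sum-zero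
    vectors to sum-zero vectors and \<open>g\<close> is an admissible direction.\<close>
  have g_sum: "(\<Sum>i\<in>I. g i) = 0"
  proof -
    have "(\<Sum>i\<in>I. \<Sum>j\<in>I. a i j * z j) = (\<Sum>j\<in>I. (\<Sum>i\<in>I. a j i) * z j)"
      by (subst sum.swap) (simp add: sum_distrib_right sym)
    also have "\<dots> = d * (\<Sum>j\<in>I. z j)"
      by (simp add: rows sum_distrib_left)
    finally show ?thesis
      using sum_z by (simp add: g_def sum_subtractf flip: sum_distrib_left)
  qed
  have q_shift: "q (\<lambda>i. z i + t * h i)
      = q z + 2 * t * (\<Sum>i\<in>I. h i * (\<Sum>j\<in>I. a i j * z j)) + t\<^sup>2 * q h" for t h
  proof -
    have "(\<Sum>i\<in>I. \<Sum>j\<in>I. a i j * z i * h j) = (\<Sum>i\<in>I. \<Sum>j\<in>I. a i j * h i * z j)"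
      by (subst sum.swap) (simp add: sym mult_ac)
    moreover have "q (\<lambda>i. z i + t * h i) = q z + t * (\<Sum>i\<in>I. \<Sum>j\<in>I. a i j * h i * z j)
        + t * (\<Sum>i\<in>I. \<Sum>j\<in>I. a i j * z i * h j) + t\<^sup>2 * q h"
      unfolding q_def
      by (simp add: algebra_simps power2_eq_square sum.distrib sum_distrib_left)
    moreover have "(\<Sum>i\<in>I. h i * (\<Sum>j\<in>I. a i j * z j)) = (\<Sum>i\<in>I. \<Sum>j\<in>I. a i j * h i * z j)"
      by (simp add: sum_distrib_left mult_ac)
    ultimately show ?thesis by simp
  qed
  \<comment> \<open>Along \<open>z + t * g\<close> the gap in \<open>bound\<close> is nonnegative
    and is 0 at \<open>t = 0\<close>; its linear coefficient is twice the squared norm of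
    \<open>g\<close>.\<close>
  have "(\<Sum>i\<in>I. (g i)\<^sup>2) = 0"
  proof (rule linear_coeff_zero_if_nonneg)
    fix t
    have "(\<Sum>i\<in>I. z i + t * g i) = 0"
      using sum_z g_sum by (simp add: sum.distrib flip: sum_distrib_left)
    then have "q (\<lambda>i. z i + t * g i) \<le> \<mu> * (\<Sum>i\<in>I. (z i + t * g i)\<^sup>2)"
      by (rule bound)
    also have "(\<Sum>i\<in>I. (z i + t * g i)\<^sup>2)
        = 1 + 2 * t * (\<Sum>i\<in>I. g i * z i) + t\<^sup>2 * (\<Sum>i\<in>I. (g i)\<^sup>2)"
      unfolding norm_z[symmetric]
      by (simp add: power2_eq_square algebra_simps sum.distrib sum_distrib_left)
    finally have "0 \<le> 2 * t * (\<mu> * (\<Sum>i\<in>I. g i * z i) - (\<Sum>i\<in>I. g i * (\<Sum>j\<in>I. a i j * z j)))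
        + t\<^sup>2 * (\<mu> * (\<Sum>i\<in>I. (g i)\<^sup>2) - q g)"
      unfolding q_shift by (simp add: \<mu>_def algebra_simps)
    also have "\<mu> * (\<Sum>i\<in>I. g i * z i) - (\<Sum>i\<in>I. g i * (\<Sum>j\<in>I. a i j * z j)) = (\<Sum>i\<in>I. (g i)\<^sup>2)"
    proof -
      have "(\<Sum>i\<in>I. (g i)\<^sup>2) = (\<Sum>i\<in>I. \<mu> * (g i * z i) - g i * (\<Sum>j\<in>I. a i j * z j))"
        by (intro sum.cong refl) (simp add: g_def power2_eq_square algebra_simps)
      then show ?thesis by (simp add: sum_subtractf sum_distrib_left)
    qed
    finally show "0 \<le> 2 * t * (\<Sum>i\<in>I. (g i)\<^sup>2) + t\<^sup>2 * (\<mu> * (\<Sum>i\<in>I. (g i)\<^sup>2) - q g)" .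
  qed
  then have "g i = 0" if "i \<in> I" for i
    using that pos[OF that, of g] by force
  then have eig: "(\<Sum>j\<in>I. a i j * z j) = \<mu> * z i" if "i \<in> I" for i
    using that by (simp add: g_def)
  have "\<exists>i\<in>I. z i \<noteq> 0"
    using norm_z by (rule_tac ccontr) auto
  then show ?thesis
    using that sum_z eig bound unfolding q_def by blast
qed

section \<open>The adjacency form of a regular graph\<close>

text \<open>The adjacency matrix indexed by vertices instead of list positions, so that sums range
  over \<open>V\<close> and the enumeration \<open>vs\<close> matters only for the spectrum.\<close>

definition adj :: "'a set set \<Rightarrow> 'a \<Rightarrow> 'a \<Rightarrow> real" where
  "adj E u v = (if {u, v} \<in> E then 1 else 0)"

lemma adj_commute: "adj E u v = adj E v u"
  by (simp add: adj_def insert_commute)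

lemma sum_adj_eq_edge_count:
  assumes "finite S" "finite T"
  shows "(\<Sum>s\<in>S. \<Sum>t\<in>T. adj E s t) = real (edge_count E S T)"
proof -
  have "(\<Sum>s\<in>S. \<Sum>t\<in>T. adj E s t) = (\<Sum>(s, t)\<in>S \<times> T. adj E s t)"
    by (rule sum.cartesian_product)
  also have "\<dots> = (\<Sum>x\<in>{(s, t). s \<in> S \<and> t \<in> T \<and> {s, t} \<in> E}. 1)"
    by (rule sum.mono_neutral_cong_right) (use assms in \<open>auto simp: adj_def split: if_splits\<close>)
  finally show ?thesis
    by (simp add: edge_count_def)
qed

lemma sum_adj_regular:
  assumes "finite V" "regular_graph V E d" "u \<in> V"
  shows "(\<Sum>v\<in>V. adj E u v) = real d"
proof -
  have "(\<Sum>v\<in>V. adj E u v) = real (card {v \<in> V. {u, v} \<in> E})"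
    using assms(1) by (simp add: adj_def sum.If_cases Int_def)
  then show ?thesis
    using assms by (simp add: regular_graph_def)
qed

lemma graph_lambda_nonneg: "graph_lambda vs E \<ge> 0"
  by (simp add: graph_lambda_def Let_def le_max_iff_disj)

text \<open>The all-ones vector has eigenvalue \<open>d\<close>, and \<open>z\<close> is orthogonal
  to it. Thus \<open>d\<close> and \<mu> both occur in the spectrum, and as separate copies even if
  they coincide, so \<mu> is one of the nontrivial eigenvalues.\<close>

lemma abs_eigenvalue_le_graph_lambda:
  assumes vs: "distinct vs" "set vs = V" and reg: "regular_graph V E d"
    and less: "graph_lambda vs E < real d"
    and z: "(\<Sum>v\<in>V. z v) = 0" "\<exists>v\<in>V. z v \<noteq> 0"
    and eig: "\<And>u. u \<in> V \<Longrightarrow> (\<Sum>v\<in>V. adj E u v * z v) = \<mu> * z u"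
  shows "\<bar>\<mu>\<bar> \<le> graph_lambda vs E"
proof -
  let ?n = "length vs" and ?A = "adj_matrix vs E" and ?p = "char_poly (adj_matrix vs E)"
  have finV: "finite V"
    using vs by auto
  have A: "?A \<in> carrier_mat ?n ?n"
    by (simp add: adj_matrix_def)
  have bij: "bij_betw ((!) vs) {..<?n} V"
    using bij_betw_nth[OF vs(1)] vs(2) by simp
  have row: "(\<Sum>c<?n. ?A $$ (r, c) * x (vs ! c)) = (\<Sum>v\<in>V. adj E (vs ! r) v * x v)"
    if "r < ?n" for r x
  proof -
    have "(\<Sum>c<?n. ?A $$ (r, c) * x (vs ! c)) = (\<Sum>c<?n. adj E (vs ! r) (vs ! c) * x (vs ! c))"
      using that by (intro sum.cong refl) (simp add: adj_matrix_def adj_def)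
    then show ?thesis
      using sum.reindex_bij_betw[OF bij, of "\<lambda>v. adj E (vs ! r) v * x v"] by simp
  qed
  have mem: "vs ! r \<in> V" if "r < ?n" for r
    using that vs(2) by auto
  have eig_d: "(\<Sum>c<?n. ?A $$ (r, c) * 1) = real d * 1" if "r < ?n" for r
    using row[OF that, of "\<lambda>_. 1"] sum_adj_regular[OF finV reg mem[OF that]] by simp
  have eig_\<mu>: "(\<Sum>c<?n. ?A $$ (r, c) * z (vs ! c)) = \<mu> * z (vs ! r)" if "r < ?n" for r
    using row[OF that] eig[OF mem[OF that]] by simp
  obtain j where j: "j < ?n" "z (vs ! j) \<noteq> 0"
    using z(2) vs(2) by (metis in_set_conv_nth)
  have p0: "?p \<noteq> 0"
    using degree_monic_char_poly[OF A] by auto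
  have "eigenvalue ?A (real d)"
    by (rule eigenvalue_if_sum[OF A eig_d j(1)]) auto
  then have root_d: "order (real d) ?p \<ge> 1"
    using eigenvalue_root_char_poly[OF A] order_root p0 by (metis One_nat_def Suc_leI not_gr_zero)
  have "eigenvalue ?A \<mu>"
    by (rule eigenvalue_if_sum[where x = "\<lambda>i. z (vs ! i)", OF A eig_\<mu> j])
  then have root_\<mu>: "order \<mu> ?p \<ge> 1"
    using eigenvalue_root_char_poly[OF A] order_root p0 by (metis One_nat_def Suc_leI not_gr_zero)
  \<comment> \<open>If the two values coincide, the all-ones vector and \<open>z\<close> span a
    two-dimensional eigenspace.\<close>
  have double: "order \<mu> ?p \<ge> 2" if "\<mu> = real d"
  proof (rule order_char_poly_ge_2[OF A, where v = "\<lambda>_. 1" and w = "\<lambda>i. z (vs ! i)"])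
    fix a b assume *: "\<And>i. i < ?n \<Longrightarrow> a * 1 + b * z (vs ! i) = 0"
    \<comment> \<open>Summing all coordinates removes the part from \<open>z\<close> and isolates
      \<open>a\<close>.\<close>
    have "0 = (\<Sum>i<?n. a * 1 + b * z (vs ! i))"
      using * by simp
    also have "\<dots> = real ?n * a + b * (\<Sum>i<?n. z (vs ! i))"
      by (simp add: sum.distrib sum_distrib_left)
    also have "(\<Sum>i<?n. z (vs ! i)) = 0"
      using sum.reindex_bij_betw[OF bij, of z] z(1) by simp
    finally have "a = 0"
      using j(1) by auto
    then show "a = 0 \<and> b = 0"
      using *[OF j(1)] j(2) by simp
  qed (use that eig_d eig_\<mu> in auto)
  have "{#real d, \<mu>#} \<subseteq># proots ?p"
    unfolding subseteq_mset_def using root_d root_\<mu> double p0 by auto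
  then show ?thesis
    using abs_le_second_eigenvalue[of "real d" \<mu> ?A] less
    by (simp add: graph_lambda_def Let_def)
qed

text \<open>The maximal Rayleigh quotients of the form and of its negation bound it from above and
  below. Both are attained at sum-zero eigenvectors, whose eigenvalues are controlled by
  \<open>graph_lambda\<close>.\<close>

lemma quadratic_form_bound:
  assumes fin: "finite V" and card: "card V \<ge> 2"
    and vs: "distinct vs" "set vs = V" and reg: "regular_graph V E d"
    and less: "graph_lambda vs E < real d"
    and x: "(\<Sum>v\<in>V. x v) = 0"
  shows "\<bar>\<Sum>u\<in>V. \<Sum>v\<in>V. adj E u v * x u * x v\<bar> \<le> graph_lambda vs E * (\<Sum>v\<in>V. (x v)\<^sup>2)"
proof -
  have mono: "c * (\<Sum>v\<in>V. (x v)\<^sup>2) \<le> graph_lambda vs E * (\<Sum>v\<in>V. (x v)\<^sup>2)"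
    if "\<bar>c\<bar> \<le> graph_lambda vs E" for c
    using that by (intro mult_right_mono sum_nonneg) auto
  obtain z \<mu> where z: "(\<Sum>v\<in>V. z v) = 0" "\<exists>v\<in>V. z v \<noteq> 0"
    and eig: "\<And>u. u \<in> V \<Longrightarrow> (\<Sum>v\<in>V. adj E u v * z v) = \<mu> * z u"
    and upper: "\<And>x. (\<Sum>v\<in>V. x v) = 0 \<Longrightarrow>
      (\<Sum>u\<in>V. \<Sum>v\<in>V. adj E u v * x u * x v) \<le> \<mu> * (\<Sum>v\<in>V. (x v)\<^sup>2)"
    by (rule rayleigh_max[OF fin card, of "adj E" "real d"])
      (use adj_commute sum_adj_regular[OF fin reg] in auto)
  obtain z' \<mu>' where z': "(\<Sum>v\<in>V. z' v) = 0" "\<exists>v\<in>V. z' v \<noteq> 0"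
    and eig': "\<And>u. u \<in> V \<Longrightarrow> (\<Sum>v\<in>V. - adj E u v * z' v) = \<mu>' * z' u"
    and lower: "\<And>x. (\<Sum>v\<in>V. x v) = 0 \<Longrightarrow>
      (\<Sum>u\<in>V. \<Sum>v\<in>V. - adj E u v * x u * x v) \<le> \<mu>' * (\<Sum>v\<in>V. (x v)\<^sup>2)"
    by (rule rayleigh_max[OF fin card, of "\<lambda>u v. - adj E u v" "- real d"])
      (use adj_commute sum_adj_regular[OF fin reg] in \<open>auto simp: sum_negf\<close>)
  have "\<bar>\<mu>\<bar> \<le> graph_lambda vs E"
    by (rule abs_eigenvalue_le_graph_lambda[OF vs reg less z eig])
  then have 1: "(\<Sum>u\<in>V. \<Sum>v\<in>V. adj E u v * x u * x v) \<le> graph_lambda vs E * (\<Sum>v\<in>V. (x v)\<^sup>2)"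
    using upper[OF x] mono[of \<mu>] by linarith
  \<comment> \<open>An eigenvalue \<mu>' of the negated form is the eigenvalue
    \<open>- \<mu>'\<close> of the adjacency form.\<close>
  have "(\<Sum>v\<in>V. adj E u v * z' v) = - \<mu>' * z' u" if "u \<in> V" for u
    using eig'[OF that] by (simp add: sum_negf)
  then have "\<bar>- \<mu>'\<bar> \<le> graph_lambda vs E"
    by (rule abs_eigenvalue_le_graph_lambda[OF vs reg less z'])
  then have "(\<Sum>u\<in>V. \<Sum>v\<in>V. - adj E u v * x u * x v) \<le> graph_lambda vs E * (\<Sum>v\<in>V. (x v)\<^sup>2)"
    using lower[OF x] mono[of \<mu>'] by simp
  then show ?thesis
    using 1 by (simp add: sum_negf)
qed

section \<open>Expander mixing for a cut\<close>

text \<open>The centred indicator \<open>x\<close> of \<open>W\<close> has squared norm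
  \<open>w * (n - w) / n\<close>, and its adjacency form equals \<open>d\<close> times this norm
  minus \<open>e\<close>. The quadratic form bound thus confines \<open>e\<close> on both
  sides.\<close>

lemma expander_cut_bounds:
  assumes fin: "finite V" and card: "card V \<ge> 2"
    and vs: "distinct vs" "set vs = V" and reg: "regular_graph V E d"
    and less: "graph_lambda vs E < real d"
    and WV: "W \<subseteq> V"
  defines "n \<equiv> real (card V)" and "w \<equiv> real (card W)" and "e \<equiv> real (edge_count E (V - W) W)"
  shows "(real d - graph_lambda vs E) * w * (n - w) \<le> n * e"
    and "n * e \<le> (real d + graph_lambda vs E) * w * (n - w)"
proof -
  let ?l = "graph_lambda vs E"
  \<comment> \<open>The mean of the indicator of \<open>W\<close>; subtracting it makes the sum
    zero.\<close>
  define c where "c = w / n"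
  define x where "x v = indicator W v - c" for v
  have finW: "finite W"
    using WV fin finite_subset by blast
  have n: "n > 0"
    using card by (simp add: n_def)
  have ind: "(\<Sum>v\<in>V. f v * indicator W v) = (\<Sum>v\<in>W. f v)" for f :: "'a \<Rightarrow> real"
    by (rule sum.mono_neutral_cong_right[OF fin WV]) auto
  have row: "(\<Sum>v\<in>V. adj E u v) = real d" if "u \<in> V" for u
    by (rule sum_adj_regular[OF fin reg that])
  have sum_x: "(\<Sum>v\<in>V. x v) = 0"
    using ind[of "\<lambda>_. 1"] n by (simp add: x_def sum_subtractf c_def w_def n_def del: sum_indicator_eq_card)
  have norm_x: "(\<Sum>v\<in>V. (x v)\<^sup>2) = w - w * c"
  proof -
    have "(x v)\<^sup>2 = (1 - 2 * c) * indicator W v + c\<^sup>2" for v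
      by (auto simp: x_def indicator_def power2_eq_square algebra_simps)
    then have "(\<Sum>v\<in>V. (x v)\<^sup>2) = (1 - 2 * c) * w + n * c\<^sup>2"
      using ind[of "\<lambda>_. 1 - 2 * c"] by (simp add: sum.distrib w_def n_def)
    also have "n * c\<^sup>2 = w * c"
      using n by (simp add: c_def power2_eq_square)
    finally show ?thesis by (simp add: algebra_simps)
  qed
  have inner: "(\<Sum>v\<in>V. adj E u v * x v) = (\<Sum>v\<in>W. adj E u v) - real d * c" if "u \<in> V" for u
  proof -
    have "(\<Sum>v\<in>V. adj E u v * x v) = (\<Sum>v\<in>V. adj E u v * indicator W v) - (\<Sum>v\<in>V. adj E u v) * c"
      by (simp only: x_def right_diff_distrib sum_subtractf sum_distrib_right)
    then show ?thesis
      by (simp only: ind row[OF that])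
  qed
  have total: "(\<Sum>u\<in>V. \<Sum>v\<in>W. adj E u v) = real d * w"
  proof -
    have "(\<Sum>u\<in>V. adj E u v) = real d" if "v \<in> W" for v
      using row[of v] that WV by (subst adj_commute) auto
    then show ?thesis
      by (subst sum.swap) (simp add: w_def)
  qed
  \<comment> \<open>Of the \<open>d * w\<close> adjacent ordered pairs ending in \<open>W\<close>,
    exactly \<open>e\<close> start outside it.\<close>
  have within: "(\<Sum>u\<in>W. \<Sum>v\<in>W. adj E u v) = real d * w - e"
  proof -
    have "(\<Sum>u\<in>V. \<Sum>v\<in>W. adj E u v) = (\<Sum>u\<in>V - W. \<Sum>v\<in>W. adj E u v) + (\<Sum>u\<in>W. \<Sum>v\<in>W. adj E u v)"
      by (rule sum.subset_diff[OF WV fin])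
    then show ?thesis
      using total fin finW by (simp add: sum_adj_eq_edge_count e_def)
  qed
  have "(\<Sum>u\<in>V. \<Sum>v\<in>V. adj E u v * x u * x v) = (\<Sum>u\<in>V. x u * (\<Sum>v\<in>V. adj E u v * x v))"
    by (simp only: sum_distrib_left mult.assoc mult.left_commute)
  also have "\<dots> = (\<Sum>u\<in>V. x u * ((\<Sum>v\<in>W. adj E u v) - real d * c))"
    by (intro sum.cong refl) (simp only: inner)
  also have "\<dots> = (\<Sum>u\<in>V. x u * (\<Sum>v\<in>W. adj E u v)) - (\<Sum>u\<in>V. x u) * (real d * c)"
    by (simp only: right_diff_distrib sum_subtractf sum_distrib_right)
  \<comment> \<open>The constant part of the inner sums drops out because \<open>x\<close> has sum
    zero.\<close>
  also have "\<dots> = (\<Sum>u\<in>V. (\<Sum>v\<in>W. adj E u v) * indicator W u - c * (\<Sum>v\<in>W. adj E u v))"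
    unfolding sum_x by (simp add: x_def left_diff_distrib mult.commute)
  also have "\<dots> = (\<Sum>u\<in>V. (\<Sum>v\<in>W. adj E u v) * indicator W u) - c * (\<Sum>u\<in>V. \<Sum>v\<in>W. adj E u v)"
    by (simp only: sum_subtractf sum_distrib_left)
  also have "\<dots> = real d * (w - w * c) - e"
    unfolding ind total within by (simp add: algebra_simps)
  finally have dev: "\<bar>real d * (w - w * c) - e\<bar> \<le> ?l * (w - w * c)"
    using quadratic_form_bound[OF fin card vs reg less sum_x] by (simp only: norm_x)
  have scale: "n * (k * (w - w * c)) = k * w * (n - w)" for k
    using n by (simp add: c_def field_simps)
  have "(real d - ?l) * (w - w * c) \<le> e" "e \<le> (real d + ?l) * (w - w * c)"
    using dev by (simp_all only: abs_le_iff left_diff_distrib distrib_right) linarith+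
  then have "n * ((real d - ?l) * (w - w * c)) \<le> n * e" "n * e \<le> n * ((real d + ?l) * (w - w * c))"
    using n by (simp_all only: mult_le_cancel_left_pos)
  then show "(real d - ?l) * w * (n - w) \<le> n * e" "n * e \<le> (real d + ?l) * w * (n - w)"
    by (simp_all only: scale)
qed

section \<open>The growth process and the resulting size bounds\<close>

text \<open>Holds for every outcome of positive probability: a step moves the chosen vertex from
  queue to processed and its new neighbours from unvisited to queue, so no visited vertex is
  lost.\<close>

lemma random_growth_invariant:
  assumes "finite V" "v1 \<in> V" "(P, Q, U) \<in> set_pmf (random_growth V E v1 t)"
  shows "P \<union> Q \<subseteq> V \<and> U = V - (P \<union> Q) \<and> v1 \<in> P \<union> Q"
  using assms(3)
proof (induction t arbitrary: P Q U)
  case 0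
  then show ?case using assms(2) by auto
next
  case (Suc t)
  then obtain s where s: "s \<in> set_pmf (random_growth V E v1 t)" "(P, Q, U) \<in> set_pmf (growth_step E s)"
    by (auto simp: set_bind_pmf)
  obtain P' Q' U' where [simp]: "s = (P', Q', U')"
    by (cases s)
  have IH: "P' \<union> Q' \<subseteq> V" "U' = V - (P' \<union> Q')" "v1 \<in> P' \<union> Q'"
    using Suc.IH[of P' Q' U'] s(1) by simp_all
  have step: "(P, Q, U) \<in> set_pmf (growth_step E (P', Q', U'))"
    using s(2) by simp
  show ?case
  proof (cases "Q' = {}")
    case True
    then show ?thesis using IH step by (auto simp: growth_step_def)
  next
    case False
    \<comment> \<open>The support of \<open>pmf_of_set\<close> is the queue itself only for a finite
      nonempty set.\<close>
    have "finite Q'"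
      using IH(1) assms(1) by (meson finite_subset le_sup_iff)
    then obtain v where "v \<in> Q'" "(P, Q, U) = growth_update E (P', Q', U') v"
      using step False by (auto simp: growth_step_def)
    then show ?thesis
      using IH by (auto simp: growth_update_def Let_def)
  qed
qed

theorem mainTheorem4:
  fixes V W P Q U :: "'a set" and E :: "'a set set" and vs :: "'a list"
    and v1 :: 'a and n d t :: nat and lam :: real
  assumes "simple_graph V E"
    and "card V = n"
    and "regular_graph V E d"
    and "distinct vs" and "set vs = V"
    and "lam = graph_lambda vs E"
    and "lam < real d"
    and "v1 \<in> V"
    and "(P, Q, U) \<in> set_pmf (random_growth V E v1 t)"
    and "W = P \<union> Q"
  shows "((real d - lam) * real (card W) - real (edge_count E U W) > 0 \<longrightarrow>
            (real d - lam) * (real (card W))\<^sup>2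
              / ((real d - lam) * real (card W) - real (edge_count E U W)) \<ge> real n) \<and>
         (real d + lam) * real (card W) - real (edge_count E U W) > 0 \<and>
         real n \<ge> (real d + lam) * (real (card W))\<^sup>2
              / ((real d + lam) * real (card W) - real (edge_count E U W))"
proof -
  have fin: "finite V"
    using assms(1) by (simp add: simple_graph_def)
  have inv: "W \<subseteq> V" "U = V - W" "v1 \<in> W"
    using random_growth_invariant[OF fin assms(8,9)] assms(10) by auto
  have lam: "lam \<ge> 0"
    using assms(6) graph_lambda_nonneg by simp
  have d: "d > 0"
    using lam assms(7) by simp
  \<comment> \<open>Positive degree gives \<open>v1\<close> a neighbour, distinct from it because
    edges have two elements.\<close>
  have "card V \<ge> 2"
  proof -
    have "card {u \<in> V. {v1, u} \<in> E} > 0"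
      using assms(3,8) d by (simp add: regular_graph_def)
    then obtain u where u: "u \<in> V" "{v1, u} \<in> E"
      by (metis (no_types, lifting) card_gt_0_iff ex_in_conv mem_Collect_eq)
    then have "card {v1, u} = 2" "{v1, u} \<subseteq> V"
      using assms(1) by (auto simp: simple_graph_def)
    then show ?thesis
      using card_mono[OF fin] by metis
  qed
  define w e where "w = real (card W)" and "e = real (edge_count E U W)"
  have w: "w > 0"
    using inv fin finite_subset by (fastforce simp: w_def card_gt_0_iff)
  have n: "real n > 0"
    using \<open>card V \<ge> 2\<close> assms(2) by simp
  have cut: "(real d - lam) * w * (real n - w) \<le> real n * e"
    "real n * e \<le> (real d + lam) * w * (real n - w)"
    using expander_cut_bounds[OF fin \<open>card V \<ge> 2\<close> assms(4,5,3) _ inv(1)] assms(2,6,7) inv(2)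
    by (simp_all add: w_def e_def)
  \<comment> \<open>The upper cut bound rearranged; as the right side is positive, the denominator
    is too.\<close>
  have "real n * ((real d + lam) * w - e) \<ge> (real d + lam) * w\<^sup>2"
    using cut(2) by (simp add: algebra_simps power2_eq_square)
  moreover have "(real d + lam) * w\<^sup>2 > 0"
    using d lam w by simp
  ultimately have pos: "(real d + lam) * w - e > 0"
    and right: "(real d + lam) * w\<^sup>2 / ((real d + lam) * w - e) \<le> real n"
    using n by (smt (verit) mult_nonneg_nonpos, smt (verit) mult_nonneg_nonpos pos_divide_le_eq)
  \<comment> \<open>Here positivity must remain a premise: for \<open>W\<close> a single vertex,
    \<open>e\<close> is \<open>d\<close> and the denominator is \<open>- lam\<close>.\<close>
  have "real n * ((real d - lam) * w - e) \<le> (real d - lam) * w\<^sup>2"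
    using cut(1) by (simp add: algebra_simps power2_eq_square)
  then have "(real d - lam) * w - e > 0 \<longrightarrow>
      real n \<le> (real d - lam) * w\<^sup>2 / ((real d - lam) * w - e)"
    by (simp add: pos_le_divide_eq)
  then show ?thesis
    using pos right by (simp add: w_def e_def)
qed

end
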